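(* For coprime integers $q,n$ with $0<q<n/2$ write $n=bq+r$ with $0\le r<q$. The billiard strings of $B_2$ ($45$-$45$-$90$ triangular table) are in bijective correspondence with the $(n,q)$-binary strings $d\in\{0,1\}^\infty$ built from two kinds of blocks, of lengths $b$ and $b+1$, each consisting of alternating digits, where adjacent blocks share the same digit (the last digit of a block equals the first digit of the next block) and the arrangement of the blocks follows from the orbit $0,-r,-2r,\dots \bmod q$: for $k\ge0$ the $k$-th block has length $b+1$ if the residue of $-kr$ modulo $q$ in $\{0,\dots,q-1\}$ is less than $r$, and length $b$ otherwise.
   Context: The $45$-$45$-$90$ triangle is unfolded by reflection to an edge-labelled tessellation of $\mathbb{R}^2$, and a billiard trajectory is unfolded to a ray $\tau$ in $\mathbb{R}^2$. Delete the diagonal edges, which are labelled $0$; the remaining edges carry two labels, which are renamed to the binary digits $0,1$. There are linearly independent vectors $v_1,v_2$ generating the lattice of vertices, such that moving from one remaining edge to the next by a unit step in $v_2$ adds $1$ to the digit modulo $2$ and by a unit step in $v_1$ adds $0$ modulo $2$. By convention, the billiard strings of $B_2$ are the resulting truncated digit strings of nonsingular rays $\tau=\{p_0+tv_0:t\ge0\}$ with $v_0=n^{-1}(qv_1+(n-q)v_2)$, with $q,n$ coprime and $0<q<n/2$, and $p_0=av_1+(1-a)v_2$ with $a>0$ negligibly small, meaning $0<a<1/n$, starting on an edge with digit $0$. Nonsingular means that $\tau$ passes through no lattice vertex. The truncated digit string of $\tau$ is $d=(d_0,d_1,\dots)$ with $d_k$ the label at $p_0+kv_0$, i.e. $d_k\equiv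 k-\lfloor a+kq/n\rfloor \pmod 2$. The $(n,q)$-binary strings start with the digit $0$. The correspondence pairs a ray's truncated digit string with the $(n,q)$-binary string for the same $q,n$. *)

theory Defs
  imports "HOL-Analysis.Analysis"
begin

definition vertex_lattice :: "real^2 \<Rightarrow> real^2 \<Rightarrow> (real^2) set" where
  "vertex_lattice v1 v2 = {of_int i *\<^sub>R v1 + of_int j *\<^sub>R v2 | i j :: int. True}"

text \<open>The starting point \<open>a v1 + (1 - a) v2\<close> of a ray lies on the segment joining the
  vertices \<open>v1\<close> and \<open>v2\<close>, and unit steps in \<open>v1\<close> and \<open>v2\<close> carry edges to edges. The edges
  remaining after deletion are therefore taken to be the lattice translates of this segment.\<close>

definition remaining_edges :: "real^2 \<Rightarrow> real^2 \<Rightarrow> (real^2) set set" where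
  "remaining_edges v1 v2 = {(+) w ` closed_segment v1 v2 | w. w \<in> vertex_lattice v1 v2}"

definition digit_labelling :: "real^2 \<Rightarrow> real^2 \<Rightarrow> ((real^2) set \<Rightarrow> nat) \<Rightarrow> bool" where
  "digit_labelling v1 v2 L \<longleftrightarrow>
     (\<forall>E \<in> remaining_edges v1 v2.
        L E \<in> {0, 1} \<and>
        L ((+) v1 ` E) = L E \<and>
        L ((+) v2 ` E) = (L E + 1) mod 2)"

definition admissible :: "nat \<Rightarrow> nat \<Rightarrow> bool" where
  "admissible q n \<longleftrightarrow> coprime q n \<and> 0 < q \<and> 2 * q < n"

definition start_point :: "real^2 \<Rightarrow> real^2 \<Rightarrow> real \<Rightarrow> real^2" where
  "start_point v1 v2 a = a *\<^sub>R v1 + (1 - a) *\<^sub>R v2"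

definition direction :: "real^2 \<Rightarrow> real^2 \<Rightarrow> nat \<Rightarrow> nat \<Rightarrow> real^2" where
  "direction v1 v2 q n = (1 / real n) *\<^sub>R (real q *\<^sub>R v1 + (real n - real q) *\<^sub>R v2)"

definition ray :: "real^2 \<Rightarrow> real^2 \<Rightarrow> (real^2) set" where
  "ray p v = {p + t *\<^sub>R v | t. t \<ge> 0}"

definition nonsingular :: "real^2 \<Rightarrow> real^2 \<Rightarrow> (real^2) set \<Rightarrow> bool" where
  "nonsingular v1 v2 \<tau> \<longleftrightarrow> \<tau> \<inter> vertex_lattice v1 v2 = {}"

definition truncated_digit_string ::
  "real^2 \<Rightarrow> real^2 \<Rightarrow> ((real^2) set \<Rightarrow> nat) \<Rightarrow> real^2 \<Rightarrow> real^2 \<Rightarrow> (nat \<Rightarrow> nat) \<Rightarrow> bool" where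
  "truncated_digit_string v1 v2 L p v d \<longleftrightarrow>
     (\<forall>k. \<exists>E \<in> remaining_edges v1 v2. p + real k *\<^sub>R v \<in> E \<and> d k = L E)"

definition billiard_strings_of ::
  "real^2 \<Rightarrow> real^2 \<Rightarrow> ((real^2) set \<Rightarrow> nat) \<Rightarrow> nat \<Rightarrow> nat \<Rightarrow> (nat \<Rightarrow> nat) set" where
  "billiard_strings_of v1 v2 L q n =
     {d. \<exists>a. 0 < a \<and> a < 1 / real n \<and>
             nonsingular v1 v2 (ray (start_point v1 v2 a) (direction v1 v2 q n)) \<and>
             truncated_digit_string v1 v2 L (start_point v1 v2 a) (direction v1 v2 q n) d}"

definition billiard_strings ::
  "real^2 \<Rightarrow> real^2 \<Rightarrow> ((real^2) set \<Rightarrow> nat) \<Rightarrow> (nat \<Rightarrow> nat) set" where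
  "billiard_strings v1 v2 L =
     {d. \<exists>q n. admissible q n \<and> d \<in> billiard_strings_of v1 v2 L q n}"

definition block_length :: "nat \<Rightarrow> nat \<Rightarrow> nat \<Rightarrow> nat" where
  "block_length n q k =
     (let b = n div q; r = n mod q
      in if (- (int k * int r)) mod int q < int r then b + 1 else b)"

definition block_start :: "nat \<Rightarrow> nat \<Rightarrow> nat \<Rightarrow> nat" where
  "block_start n q k = (\<Sum>i<k. block_length n q i)"

text \<open>Block \<open>k\<close> occupies the positions from \<open>block_start n q k\<close> up to, but excluding,
  \<open>block_start n q (Suc k)\<close>. Consecutive blocks do not overlap: the shared digit is written
  twice, once at the end of a block and once at the beginning of the next.\<close>

definition nq_binary_string :: "nat \<Rightarrow> nat \<Rightarrow> (nat \<Rightarrow> nat) \<Rightarrow> bool" where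
  "nq_binary_string n q d \<longleftrightarrow>
     (\<forall>i. d i \<in> {0, 1}) \<and>
     d 0 = 0 \<and>
     (\<forall>k i. block_start n q k \<le> i \<and> Suc i < block_start n q (Suc k) \<longrightarrow> d (Suc i) \<noteq> d i) \<and>
     (\<forall>k. d (block_start n q (Suc k) - 1) = d (block_start n q (Suc k)))"

definition nq_binary_strings :: "(nat \<Rightarrow> nat) set" where
  "nq_binary_strings = {d. \<exists>q n. admissible q n \<and> nq_binary_string n q d}"

end

theory Submission
  imports Defs
begin

text \<open>Both sides of the correspondence are, for each admissible pair \<open>q, n\<close>, a single string, and
  it is the same string, so the identity map does the job.

  In the coordinates given by \<open>v1, v2\<close> the coordinate sum of \<open>p + t v\<close> is \<open>1 + t\<close>, so the points
  of the ray at integer times \<open>k\<close> are exactly those on the lines carrying the remaining edges, and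
  the first coordinate there is \<open>a + k q / n\<close>. Since \<open>0 < a < 1 / n\<close>, this number is never an
  integer, whence the ray is nonsingular and meets just one edge at time \<open>k\<close>; and its floor is that
  of \<open>k q / n\<close>, so every such \<open>a\<close> gives the same string. That edge is the translate of the segment
  from \<open>v1\<close> to \<open>v2\<close> by \<open>\<lfloor>k q / n\<rfloor>\<close> steps in \<open>v1\<close> and \<open>k - \<lfloor>k q / n\<rfloor>\<close> steps in \<open>v2\<close>, and
  only the latter change the label, which is therefore the parity of their number
  (\<open>billiard_strings_of_eq\<close>).

  This parity changes from \<open>k\<close> to \<open>k + 1\<close> exactly when \<open>\<lfloor>k q / n\<rfloor>\<close> does not, so the string falls
  into alternating blocks on which \<open>\<lfloor>k q / n\<rfloor>\<close> is constant, and block \<open>m\<close> begins at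
  \<open>\<lceil>m n / q\<rceil>\<close>. The rounding error \<open>q \<lceil>m n / q\<rceil> - m n\<close> is the residue of \<open>-m r\<close> modulo \<open>q\<close>;
  it drops by \<open>r\<close> modulo \<open>q\<close> from one block to the next, and it wraps around precisely
  when it is less than \<open>r\<close>, which makes the block longer by one
  (\<open>block_start_times\<close>, \<open>block_start_le_iff\<close>). So the block description determines where
  the digit is repeated, hence the whole string (\<open>nq_binary_string_iff\<close>).\<close>

definition rotation_string :: "nat \<Rightarrow> nat \<Rightarrow> nat \<Rightarrow> nat" where
  "rotation_string q n k = (k - k * q div n) mod 2"


section \<open>The digits along a ray\<close>

lemma independent_pair_coordinates:
  fixes v1 v2 :: "'a::real_vector"
  assumes ind: "independent {v1, v2}" and ne: "v1 \<noteq> v2"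
    and eq: "x *\<^sub>R v1 + y *\<^sub>R v2 = x' *\<^sub>R v1 + y' *\<^sub>R v2"
  shows "x = x' \<and> y = y'"
proof -
  define u where "u v = (if v = v1 then x - x' else y - y')" for v
  have "(\<Sum>v\<in>{v1, v2}. u v *\<^sub>R v) = 0"
    using ne eq by (simp add: u_def algebra_simps)
  then have "u v = 0" if "v \<in> {v1, v2}" for v
    using independentD[OF ind, of "{v1, v2}" u v] that by simp
  from this[of v1] this[of v2] show ?thesis
    using ne by (simp add: u_def)
qed

lemma ray_point:
  assumes "n > 0"
  shows "start_point v1 v2 a + t *\<^sub>R direction v1 v2 q n =
    (a + t * real q / real n) *\<^sub>R v1 + (1 + t - (a + t * real q / real n)) *\<^sub>R v2"
proof -
  have "direction v1 v2 q n = (real q / real n) *\<^sub>R v1 + (1 - real q / real n) *\<^sub>R v2"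
    using assms by (simp add: direction_def scaleR_add_right diff_divide_distrib)
  then show ?thesis
    unfolding start_point_def by (simp only:) (simp add: algebra_simps)
qed

text \<open>The residue of \<open>k q\<close> modulo \<open>n\<close> is at most \<open>n - 1\<close>, so adding \<open>a < 1 / n\<close> to \<open>k q / n\<close> cannot
  reach the next integer; \<open>a > 0\<close> keeps the sum off the integer below.\<close>
lemma perturbed_rotation_bounds:
  assumes "n > 0" and a: "0 < a" "a < 1 / real n"
  shows "real (k * q div n) < a + real k * real q / real n"
    and "a + real k * real q / real n < real (k * q div n) + 1"
proof -
  have "real k * real q = real (k * q div n) * real n + real (k * q mod n)"
    by (metis div_mult_mod_eq of_nat_add of_nat_mult)
  then have eq: "real k * real q / real n = real (k * q div n) + real (k * q mod n) / real n"
    using \<open>n > 0\<close> by (simp add: field_simps)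
  show "real (k * q div n) < a + real k * real q / real n"
    using a unfolding eq by (simp add: add_pos_nonneg)
  have "real (k * q mod n) + 1 \<le> real n"
    using \<open>n > 0\<close> mod_less_divisor[of n "k * q"] by linarith
  then have "real (k * q mod n) / real n + 1 / real n \<le> 1"
    using \<open>n > 0\<close> by (simp add: field_simps)
  then show "a + real k * real q / real n < real (k * q div n) + 1"
    using a unfolding eq by linarith
qed

lemma floor_perturbed_rotation:
  assumes "n > 0" "0 < a" "a < 1 / real n"
  shows "\<lfloor>a + real k * real q / real n\<rfloor> = int (k * q div n)"
  using perturbed_rotation_bounds[OF assms, of k q] by (intro floor_unique) auto

lemma nonsingular_ray:
  fixes v1 v2 :: "real^2"
  assumes ind: "independent {v1, v2}" "v1 \<noteq> v2"
    and n: "n > 0" and a: "0 < a" "a < 1 / real n"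
  shows "nonsingular v1 v2 (ray (start_point v1 v2 a) (direction v1 v2 q n))"
proof (rule ccontr)
  assume "\<not> ?thesis"
  then obtain t i j where t: "t \<ge> 0" and
    "start_point v1 v2 a + t *\<^sub>R direction v1 v2 q n = of_int i *\<^sub>R v1 + of_int j *\<^sub>R v2"
    unfolding nonsingular_def ray_def vertex_lattice_def by blast
  from independent_pair_coordinates[OF ind this(2)[unfolded ray_point[OF n]]]
  have i: "a + t * real q / real n = of_int i" and "1 + t - (a + t * real q / real n) = of_int j"
    by auto
  then have "t = of_int (i + j - 1)"
    by simp
  with t have "t = real (nat (i + j - 1))"
    by simp
  then show False
    using perturbed_rotation_bounds[OF n a, of "nat (i + j - 1)" q] i
    by (smt (verit) of_int_less_iff of_int_of_nat_eq of_int_add of_int_1)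
qed

text \<open>On an edge the coordinate sum is \<open>i + j + 1\<close>, which fixes \<open>i + j = k\<close>, and the first
  coordinate runs from \<open>i\<close> to \<open>i + 1\<close>. A point whose first coordinate is not an integer avoids the
  ends, where two edges meet, so its floor singles out one edge.\<close>
lemma mem_translated_edge_iff:
  fixes v1 v2 :: "real^2"
  assumes ind: "independent {v1, v2}" "v1 \<noteq> v2" and x: "of_int \<lfloor>x\<rfloor> < x"
  shows "x *\<^sub>R v1 + (1 + real k - x) *\<^sub>R v2
           \<in> (+) (of_int i *\<^sub>R v1 + of_int j *\<^sub>R v2) ` closed_segment v1 v2
         \<longleftrightarrow> i = \<lfloor>x\<rfloor> \<and> j = int k - \<lfloor>x\<rfloor>" (is "?P \<in> ?E \<longleftrightarrow> _")
proof
  assume "?P \<in> ?E"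
  then obtain s where s: "0 \<le> s" "s \<le> 1"
    and "?P = of_int i *\<^sub>R v1 + of_int j *\<^sub>R v2 + ((1 - s) *\<^sub>R v1 + s *\<^sub>R v2)"
    by (auto simp: closed_segment_def)
  then have "?P = (of_int i + (1 - s)) *\<^sub>R v1 + (of_int j + s) *\<^sub>R v2"
    by (simp add: algebra_simps)
  from independent_pair_coordinates[OF ind this]
  have c: "x = of_int i + (1 - s)" "1 + real k - x = of_int j + s"
    by auto
  then have "real_of_int (i + j) = of_int (int k)"
    by simp
  then have sum: "i + j = int k"
    by (simp only: of_int_eq_iff)
  have "s \<noteq> 0"
  proof
    assume "s = 0"
    then have "x = of_int (i + 1)"
      using c by simp
    with x show False
      by (metis floor_of_int less_irrefl)
  qed
  then have "\<lfloor>x\<rfloor> = i"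
    using c s by (intro floor_unique) auto
  with sum show "i = \<lfloor>x\<rfloor> \<and> j = int k - \<lfloor>x\<rfloor>"
    by simp
next
  assume "i = \<lfloor>x\<rfloor> \<and> j = int k - \<lfloor>x\<rfloor>"
  then have i: "i = \<lfloor>x\<rfloor>" and j: "j = int k - \<lfloor>x\<rfloor>"
    by auto
  define s where "s = 1 - (x - of_int \<lfloor>x\<rfloor>)"
  have "0 \<le> s" "s \<le> 1"
    using x by (simp_all add: s_def) linarith
  then have "(1 - s) *\<^sub>R v1 + s *\<^sub>R v2 \<in> closed_segment v1 v2"
    by (auto simp: closed_segment_def)
  moreover have "?P = of_int i *\<^sub>R v1 + of_int j *\<^sub>R v2 + ((1 - s) *\<^sub>R v1 + s *\<^sub>R v2)"
    unfolding i j s_def by (simp add: algebra_simps)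
  ultimately show "?P \<in> ?E"
    by blast
qed

lemma edge_label:
  assumes L: "digit_labelling v1 v2 L" and L0: "L (closed_segment v1 v2) = 0"
  shows "L ((+) (of_int (int i) *\<^sub>R v1 + of_int (int j) *\<^sub>R v2) ` closed_segment v1 v2) = j mod 2"
proof -
  define e where
    "e i j = (+) (of_int (int i) *\<^sub>R v1 + of_int (int j) *\<^sub>R v2) ` closed_segment v1 v2" for i j :: nat
  have e: "e i j \<in> remaining_edges v1 v2" for i j
    unfolding e_def remaining_edges_def vertex_lattice_def by blast
  have e1: "(+) v1 ` e i j = e (Suc i) j" and e2: "(+) v2 ` e i j = e i (Suc j)" for i j
    unfolding e_def image_image by (rule image_cong; simp add: algebra_simps)+
  have "L (e i j) = j mod 2"
  proof (induction i)
    case 0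
    show ?case
    proof (induction j)
      case 0
      show ?case
        using L0 by (simp add: e_def)
    next
      case (Suc j)
      then show ?case
        using L e[of 0 j] e2[of 0 j] unfolding digit_labelling_def by (metis Suc_eq_plus1 mod_Suc_eq)
    qed
  next
    case (Suc i)
    then show ?case
      using L e[of i j] e1[of i j] unfolding digit_labelling_def by metis
  qed
  then show ?thesis
    by (simp only: e_def)
qed

lemma truncated_digit_string_iff:
  fixes v1 v2 :: "real^2"
  assumes ind: "independent {v1, v2}" "v1 \<noteq> v2"
    and L: "digit_labelling v1 v2 L" "L (closed_segment v1 v2) = 0"
    and qn: "n > 0" "q \<le> n" and a: "0 < a" "a < 1 / real n"
  shows "truncated_digit_string v1 v2 L (start_point v1 v2 a) (direction v1 v2 q n) d
         \<longleftrightarrow> d = rotation_string q n"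
proof -
  have "(\<exists>E \<in> remaining_edges v1 v2.
           start_point v1 v2 a + real k *\<^sub>R direction v1 v2 q n \<in> E \<and> d k = L E)
        \<longleftrightarrow> d k = rotation_string q n k" (is "?lhs \<longleftrightarrow> _") for k
  proof -
    define m where "m = k * q div n"
    have "k * q div n \<le> k * n div n"
      using qn by (intro div_le_mono mult_le_mono2)
    then have "m \<le> k"
      using qn by (simp add: m_def)
    define x where "x = a + real k * real q / real n"
    have fl: "\<lfloor>x\<rfloor> = int m"
      unfolding x_def m_def by (rule floor_perturbed_rotation[OF qn(1) a])
    have "of_int \<lfloor>x\<rfloor> < x"
      unfolding fl using perturbed_rotation_bounds(1)[OF qn(1) a, of k q] by (simp add: x_def m_def)
    note mem = mem_translated_edge_iff[OF ind this, unfolded fl]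
    have "?lhs \<longleftrightarrow> (\<exists>i j. x *\<^sub>R v1 + (1 + real k - x) *\<^sub>R v2
                          \<in> (+) (of_int i *\<^sub>R v1 + of_int j *\<^sub>R v2) ` closed_segment v1 v2 \<and>
                   d k = L ((+) (of_int i *\<^sub>R v1 + of_int j *\<^sub>R v2) ` closed_segment v1 v2))"
      unfolding ray_point[OF qn(1)] x_def[symmetric] remaining_edges_def vertex_lattice_def by blast
    also have "\<dots> \<longleftrightarrow> d k = L ((+) (of_int (int m) *\<^sub>R v1 + of_int (int k - int m) *\<^sub>R v2)
                               ` closed_segment v1 v2)"
      unfolding mem by blast
    also have "\<dots> \<longleftrightarrow> d k = (k - m) mod 2"
      using edge_label[OF L, of m "k - m"] \<open>m \<le> k\<close> by (simp only: of_nat_diff)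
    finally show ?thesis
      by (simp add: rotation_string_def m_def)
  qed
  then show ?thesis
    unfolding truncated_digit_string_def by auto
qed

lemma billiard_strings_of_eq:
  fixes v1 v2 :: "real^2"
  assumes ind: "independent {v1, v2}" "v1 \<noteq> v2"
    and L: "digit_labelling v1 v2 L" "L (closed_segment v1 v2) = 0"
    and qn: "n > 0" "q \<le> n"
  shows "billiard_strings_of v1 v2 L q n = {rotation_string q n}"
proof -
  have "d \<in> billiard_strings_of v1 v2 L q n \<longleftrightarrow>
        (\<exists>a. 0 < a \<and> a < 1 / real n \<and> d = rotation_string q n)" for d
    unfolding billiard_strings_of_def
    using truncated_digit_string_iff[OF ind L qn] nonsingular_ray[OF ind qn(1)] by blast
  moreover have "\<exists>a. 0 < a \<and> a < 1 / real n"
    using qn by (intro dense) simp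
  ultimately show ?thesis
    by blast
qed


section \<open>The block structure of the rotation string\<close>

text \<open>This says that \<open>block_start n q k\<close> is \<open>k n / q\<close> rounded up, with the rounding error made
  explicit. In the induction the error passes from \<open>s\<close> to \<open>(s - r) mod q\<close>, which is \<open>s - r + q\<close>
  or \<open>s - r\<close>; the extra \<open>q\<close> is paid for by the extra digit of a long block.\<close>
lemma block_start_times:
  assumes "q > 0"
  shows "int (block_start n q k) * int q = int k * int n + (- (int k * int (n mod q))) mod int q"
proof (induction k)
  case 0
  show ?case
    by (simp add: block_start_def)
next
  case (Suc k)
  define r s where "r = int (n mod q)" and "s = (- (int k * r)) mod int q"
  have r: "0 \<le> r" "r < int q" and s: "0 \<le> s" "s < int q"
    using assms by (simp_all add: r_def s_def)
  have "- (int (Suc k) * r) = - (int k * r) - r"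
    by (simp add: algebra_simps)
  then have "(- (int (Suc k) * r)) mod int q = (s - r) mod int q"
    by (simp only: s_def mod_diff_left_eq)
  also have "\<dots> = (if s < r then s - r + int q else s - r)"
  proof (cases "s < r")
    case True
    have "(s - r + int q) mod int q = s - r + int q"
      using True r s by (intro mod_pos_pos_trivial) auto
    with True show ?thesis
      by simp
  next
    case False
    then show ?thesis
      using r s by (auto intro!: mod_pos_pos_trivial)
  qed
  finally have s': "(- (int (Suc k) * r)) mod int q = (if s < r then s - r + int q else s - r)" .
  have "block_start n q (Suc k) = block_start n q k + (if s < r then n div q + 1 else n div q)"
    by (simp add: block_start_def block_length_def r_def s_def Let_def)
  moreover have "int n = int (n div q) * int q + r"
    unfolding r_def by (metis div_mult_mod_eq of_nat_add of_nat_mult)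
  ultimately show ?case
    using Suc.IH unfolding r_def[symmetric] s' unfolding s_def[symmetric]
    by (auto simp: algebra_simps)
qed

lemma block_start_le_iff:
  assumes "q > 0"
  shows "block_start n q m \<le> i \<longleftrightarrow> m * n \<le> i * q"
proof -
  define s where "s = (- (int m * int (n mod q))) mod int q"
  have s: "0 \<le> s" "s < int q"
    using assms by (simp_all add: s_def)
  have eq: "int (block_start n q m) * int q = int m * int n + s"
    unfolding s_def by (rule block_start_times[OF assms])
  have "int (block_start n q m) \<le> int i" if "int m * int n \<le> int i * int q"
  proof (rule ccontr)
    assume "\<not> ?thesis"
    then have "(int i + 1) * int q \<le> int (block_start n q m) * int q"
      by (intro mult_right_mono) auto
    with eq s that show False
      by (simp add: algebra_simps)
  qed
  moreover have "int m * int n \<le> int i * int q" if "int (block_start n q m) \<le> int i"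
    using mult_right_mono[OF that, of "int q"] eq s by simp
  ultimately have "int (block_start n q m) \<le> int i \<longleftrightarrow> int (m * n) \<le> int (i * q)"
    by auto
  then show ?thesis
    by (simp only: of_nat_le_iff)
qed

lemma block_containing:
  assumes "q > 0" "n > 0"
  shows "block_start n q m \<le> i \<and> i < block_start n q (Suc m) \<longleftrightarrow> i * q div n = m"
proof -
  have "m \<le> i * q div n \<longleftrightarrow> block_start n q m \<le> i" for m
    using assms by (simp add: block_start_le_iff less_eq_div_iff_mult_less_eq)
  from this[of m] this[of "Suc m"] show ?thesis
    by (auto simp: not_le[symmetric])
qed

lemma rotation_div_Suc:
  assumes "q \<le> n"
  shows "Suc i * q div n = i * q div n \<or> Suc i * q div n = Suc (i * q div n)"
proof (cases "n = 0")
  case False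
  have "i * q div n \<le> Suc i * q div n"
    by (intro div_le_mono) simp
  moreover have "Suc i * q div n \<le> (i * q + n) div n"
    using assms by (intro div_le_mono) simp
  ultimately show ?thesis
    using False by simp linarith
qed simp

text \<open>The two conditions on blocks, alternation inside and repetition across a boundary, are
  turned into one rule for each position: the digit is repeated exactly where the block changes.
  With the initial digit this rule fixes the string.\<close>
lemma nq_binary_string_iff_repeats:
  assumes "q > 0" "q \<le> n"
  shows "nq_binary_string n q d \<longleftrightarrow>
    (\<forall>i. d i \<in> {0, 1}) \<and> d 0 = 0 \<and>
    (\<forall>i. d (Suc i) = d i \<longleftrightarrow> Suc i * q div n \<noteq> i * q div n)"
proof -
  have n: "n > 0"
    using assms by simp
  note blk = block_containing[OF assms(1) n]
  have same: "block_start n q k \<le> i \<and> Suc i < block_start n q (Suc k) \<longleftrightarrow>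
      i * q div n = k \<and> Suc i * q div n = k" for k i
    unfolding blk[symmetric] by auto
  have change: "Suc i = block_start n q (Suc k) \<longleftrightarrow>
      i * q div n = k \<and> Suc i * q div n \<noteq> k" for k i
  proof
    assume i: "Suc i = block_start n q (Suc k)"
    then have "\<not> Suc i * q div n = k"
      unfolding blk[symmetric] by simp
    moreover have "Suc i * q div n = Suc k"
    proof -
      have "block_start n q (Suc k) < block_start n q (Suc (Suc k))"
      proof -
        have "n div q \<ge> 1"
          using assms by (simp add: div_greater_zero_iff Suc_le_eq)
        then have "block_length n q (Suc k) > 0"
          by (auto simp: block_length_def Let_def)
        then show ?thesis
          by (simp add: block_start_def)
      qed
      then show ?thesis
        using i blk[of "Suc k" "Suc i"] by simp
    qed
    moreover have "block_start n q (Suc k) \<le> i \<longleftrightarrow> Suc k \<le> i * q div n"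
      using assms(1) n by (simp add: block_start_le_iff less_eq_div_iff_mult_less_eq)
    ultimately show "i * q div n = k \<and> Suc i * q div n \<noteq> k"
      using rotation_div_Suc[OF assms(2), of i] i by auto
  next
    assume "i * q div n = k \<and> Suc i * q div n \<noteq> k"
    then show "Suc i = block_start n q (Suc k)"
      unfolding blk[symmetric] by auto
  qed
  have pos: "block_start n q (Suc k) > 0" for k
    using block_start_le_iff[OF assms(1), of n "Suc k" 0] n by simp
  have "(\<forall>k. d (block_start n q (Suc k) - 1) = d (block_start n q (Suc k))) \<longleftrightarrow>
        (\<forall>k i. Suc i = block_start n q (Suc k) \<longrightarrow> d i = d (Suc i))"
    by (metis Suc_pred' pos diff_Suc_1)
  then have boundary: "(\<forall>k. d (block_start n q (Suc k) - 1) = d (block_start n q (Suc k))) \<longleftrightarrow>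
        (\<forall>i. Suc i * q div n \<noteq> i * q div n \<longrightarrow> d (Suc i) = d i)"
    unfolding change by metis
  have "(\<forall>k i. i * q div n = k \<and> Suc i * q div n = k \<longrightarrow> d (Suc i) \<noteq> d i) \<longleftrightarrow>
        (\<forall>i. Suc i * q div n = i * q div n \<longrightarrow> d (Suc i) \<noteq> d i)"
    by metis
  then show ?thesis
    unfolding nq_binary_string_def same boundary by blast
qed

lemma rotation_string_repeats:
  assumes "q \<le> n"
  shows "rotation_string q n (Suc i) = rotation_string q n i \<longleftrightarrow>
         Suc i * q div n \<noteq> i * q div n"
proof -
  have "i * q div n \<le> i"
  proof (cases "n = 0")
    case False
    have "i * q div n \<le> i * n div n"
      using assms by (intro div_le_mono mult_le_mono2)
    with False show ?thesis
      by simp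
  qed simp
  then show ?thesis
    using rotation_div_Suc[OF assms, of i]
    by (auto simp: rotation_string_def Suc_diff_le mod_Suc simp del: mult_Suc split: if_splits)
qed

lemma nq_binary_string_iff:
  assumes "q > 0" "q \<le> n"
  shows "nq_binary_string n q d \<longleftrightarrow> d = rotation_string q n"
proof
  assume "nq_binary_string n q d"
  then have d: "d i \<in> {0, 1}" "d 0 = 0"
    "d (Suc i) = d i \<longleftrightarrow> Suc i * q div n \<noteq> i * q div n" for i
    unfolding nq_binary_string_iff_repeats[OF assms] by blast+
  have e: "rotation_string q n i \<in> {0, 1}" for i
    by (auto simp: rotation_string_def)
  have "d i = rotation_string q n i" for i
  proof (induction i)
    case 0
    show ?case
      using d(2) by (simp add: rotation_string_def)
  next
    case (Suc i)
    (* two binary digits that both agree with, or both differ from, the same digit are equal *)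
    then show ?case
      using d(1)[of "Suc i"] d(1)[of i] d(3)[of i] e[of "Suc i"]
        rotation_string_repeats[OF assms(2), of i] by auto
  qed
  then show "d = rotation_string q n"
    by blast
next
  assume d: "d = rotation_string q n"
  show "nq_binary_string n q d"
    unfolding nq_binary_string_iff_repeats[OF assms] d
    using rotation_string_repeats[OF assms(2)] by (auto simp: rotation_string_def)
qed


section \<open>The correspondence\<close>

theorem theorem5p3:
  fixes v1 v2 :: "real^2" and L :: "(real^2) set \<Rightarrow> nat"
  assumes "independent {v1, v2}" and "v1 \<noteq> v2"
    and "digit_labelling v1 v2 L"
    and "L (closed_segment v1 v2) = 0"
  shows "\<exists>f. bij_betw f (billiard_strings v1 v2 L) nq_binary_strings \<and>
             (\<forall>q n. admissible q n \<longrightarrow>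
                (\<exists>!e. nq_binary_string n q e) \<and>
                bij_betw f (billiard_strings_of v1 v2 L q n) {d. nq_binary_string n q d})"
proof -
  have bill: "billiard_strings_of v1 v2 L q n = {rotation_string q n}"
    and nq: "nq_binary_string n q d \<longleftrightarrow> d = rotation_string q n"
    if "admissible q n" for q n d
    using that billiard_strings_of_eq[OF assms, of n q] nq_binary_string_iff[of q n d]
    by (auto simp: admissible_def)
  have "billiard_strings v1 v2 L = nq_binary_strings"
    unfolding billiard_strings_def nq_binary_strings_def using bill nq by blast
  then have "bij_betw id (billiard_strings v1 v2 L) nq_binary_strings"
    by simp
  moreover have "(\<exists>!e. nq_binary_string n q e) \<and>
      bij_betw id (billiard_strings_of v1 v2 L q n) {d. nq_binary_string n q d}"
    if "admissible q n" for q n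
    using bill[OF that] nq[OF that] by simp
  ultimately show ?thesis
    by blast
qed

end
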